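(* Let $f,h_1,h_2\in\mathbb{Z}[X]$ and let $(a_n)_{n\in\mathbb{N}}$ be given by $a_0=h_1(0)$, $a_n=f(n)a_{n-1}+h_1(n)h_2(n)^n$ for $n>0$. Let $d=p_1^{k_1}\cdots p_s^{k_s}\,q_1^{m_1}\cdots q_t^{m_t}$ be the factorization of a positive integer $d$ into powers of distinct primes, where each $p_i$, $i\in\{1,\dots,s\}$, does not divide $f(n)$ for any integer $n$, and each $q_i$, $i\in\{1,\dots,t\}$, divides $f(n)$ for some integer $n$. Assume that $n_0\in\mathbb{N}$ satisfies $n_0\ge k_i-1$ for $i\in\{1,\dots,s\}$ and $n_0\ge(q_i+1)v_{q_i}(d)-1$ for $i\in\{1,\dots,t\}$. Then $$\operatorname{lcm}\{p_i^{2k_i}(p_i-1),\ q_j^{m_j}(q_j-1):\ i\in\{1,\dots,s\},\ j\in\{1,\dots,t\}\}$$ is a period of the sequence of remainders $(a_n\bmod d)_{n\ge n_0}$.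
   Context: $\mathbb{N}=\{0,1,2,\dots\}$; $v_q$ is the $q$-adic valuation. A positive integer $T$ is a period of $(b_n)_{n\ge n_0}$ if $b_{n+T}=b_n$ for all $n\ge n_0$ (it need not be the least one). The convention $0^0=1$ is used. *)

theory Defs
  imports "HOL-Computational_Algebra.Computational_Algebra"
begin

text \<open>The tail \<open>(b\<^sub>n)\<close>, \<open>n \<ge> n0\<close>, of a sequence has \<open>T\<close> as a (not necessarily least) period.\<close>

definition is_period_from :: "nat \<Rightarrow> (nat \<Rightarrow> 'a) \<Rightarrow> nat \<Rightarrow> bool" where
  "is_period_from n0 b T \<longleftrightarrow> T > 0 \<and> (\<forall>n\<ge>n0. b (n + T) = b n)"

end

theory Submission
  imports Defs "HOL-Number_Theory.Residues"
begin

text \<open>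
  By the Chinese remainder theorem it suffices to treat a prime power \<open>p ^ k\<close>. Put
  \<open>P = p ^ k * (p - 1)\<close>. Modulo \<open>p ^ k\<close> both \<open>f(n)\<close> and \<open>h\<^sub>1(n) h\<^sub>2(n)\<^sup>n\<close>, for \<open>n \<ge> k\<close>, have period \<open>P\<close>, so
  \<open>D n = a (n + P) - a n\<close> satisfies the homogeneous recurrence \<open>D n = f(n) D (n - 1)\<close>.
  If \<open>p\<close> divides a value of \<open>f\<close>, a product of \<open>p * k\<close> consecutive values of \<open>f\<close> vanishes
  modulo \<open>p ^ k\<close>, hence so does \<open>D\<close>. Otherwise \<open>D (n + P) = u * D n\<close> with \<open>u\<close> congruent to \<open>1\<close>
  modulo \<open>p\<close>, and summing \<open>D (n + i * P)\<close> over \<open>i < p ^ k\<close> produces the factor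
  \<open>\<Sum>i<p ^ k. u ^ i\<close>, which is divisible by \<open>p ^ k\<close>.
\<close>

section \<open>Congruences and power periods modulo prime powers\<close>

lemma poly_cong_int:
  fixes f :: "int poly"
  assumes "[x = y] (mod m)"
  shows "[poly f x = poly f y] (mod m)"
  by (induction f) (auto intro!: cong_add cong_mult assms)

text \<open>With \<open>w = u ^ (p ^ k)\<close>, the sum of length \<open>p ^ Suc k\<close> factors
  as the sum of length \<open>p ^ k\<close> times \<open>\<Sum>i<p. w ^ i\<close>. The latter has
  \<open>p\<close> terms, all congruent to 1 modulo \<open>p\<close>, so each induction step gains a
  factor \<open>p\<close>.\<close>

lemma dvd_geometric_sum:
  fixes u :: int
  assumes "[u = 1] (mod int p)"
  shows "int p ^ k dvd (\<Sum>i<p ^ k. u ^ i)"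
\<comment> \<open>The factorization is obtained by cancelling \<open>u - 1\<close>; for
  \<open>u = 1\<close> the sum is simply \<open>p ^ k\<close>.\<close>
proof (cases "u = 1")
  case False
  show ?thesis
  proof (induction k)
    case (Suc k)
    let ?w = "u ^ (p ^ k)"
    have "(u - 1) * (\<Sum>i<p ^ Suc k. u ^ i) = ?w ^ p - 1"
      by (simp add: power_diff_1_eq [symmetric] power_mult [symmetric] mult.commute)
    also have "\<dots> = (?w - 1) * (\<Sum>i<p. ?w ^ i)"
      by (rule power_diff_1_eq)
    also have "?w - 1 = (u - 1) * (\<Sum>i<p ^ k. u ^ i)"
      by (rule power_diff_1_eq)
    finally have split: "(\<Sum>i<p ^ Suc k. u ^ i) = (\<Sum>i<p ^ k. u ^ i) * (\<Sum>i<p. ?w ^ i)"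
      using False by (simp add: mult.assoc)
    have "[(\<Sum>i<p. ?w ^ i) = (\<Sum>i<p. 1)] (mod int p)"
    proof (rule cong_sum)
      fix i
      show "[?w ^ i = 1] (mod int p)"
        using cong_pow [OF cong_pow [OF assms, of "p ^ k"], of i] by simp
    qed
    then have "int p dvd (\<Sum>i<p. ?w ^ i)"
      by (simp add: cong_0_iff [symmetric] cong_def)
    from mult_dvd_mono [OF Suc.IH this] show ?case
      unfolding split by (simp only: power_Suc2 of_nat_power of_nat_mult)
  qed simp
qed simp

text \<open>A possibly negative \<open>x\<close> is replaced by its nonnegative residue modulo
  \<open>p\<close>, to which Fermat's theorem for naturals applies.\<close>

lemma fermat_int:
  fixes x :: int
  assumes "prime p" and "\<not> int p dvd x"
  shows "[x ^ (p - 1) = 1] (mod int p)"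
proof -
  have p: "p > 0"
    using assms(1) by (rule prime_gt_0_nat)
  define y where "y = nat (x mod int p)"
  have y: "int y = x mod int p"
    using p by (simp add: y_def)
  have "\<not> int p dvd int y"
    using assms(2) by (simp add: y dvd_mod_iff)
  then have "\<not> p dvd y"
    by simp
  then have "[int (y ^ (p - 1)) = int 1] (mod int p)"
    unfolding cong_int_iff by (rule fermat_theorem [OF assms(1)])
  then have "[int y ^ (p - 1) = 1] (mod int p)"
    by simp
  moreover have "[x ^ (p - 1) = int y ^ (p - 1)] (mod int p)"
    by (rule cong_pow) (simp add: y)
  ultimately show ?thesis
    using cong_trans by blast
qed

text \<open>With \<open>u = x ^ (p - 1)\<close>, congruent to 1 modulo \<open>p\<close> by Fermat,
  \<open>u ^ (p ^ k) - 1\<close> has the geometric sum of length \<open>p ^ k\<close> as a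
  factor.\<close>

lemma euler_prime_power_int:
  fixes x :: int
  assumes "prime p" and "\<not> int p dvd x"
  shows "[x ^ (p ^ k * (p - 1)) = 1] (mod int p ^ k)"
proof -
  let ?u = "x ^ (p - 1)"
  have "?u ^ (p ^ k) - 1 = (?u - 1) * (\<Sum>i<p ^ k. ?u ^ i)"
    by (rule power_diff_1_eq)
  with dvd_geometric_sum [OF fermat_int [OF assms], of k]
  have "int p ^ k dvd ?u ^ (p ^ k) - 1"
    by simp
  then show ?thesis
    by (simp add: cong_iff_dvd_diff power_mult [symmetric] mult.commute)
qed

text \<open>\<open>P\<close> is a multiple of \<open>p ^ k\<close>, so the bases agree. If
  \<open>p\<close> does not divide the base, shifting the exponent by \<open>P\<close> is harmless
  by Euler; otherwise both exponents are at least \<open>k\<close> and both powers vanish.\<close>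

lemma cong_self_power_period:
  fixes h :: "int poly"
  assumes "prime p" and "k \<le> n"
  defines "P \<equiv> p ^ k * (p - 1)"
  shows "[poly h (int (n + P)) ^ (n + P) = poly h (int n) ^ n] (mod int p ^ k)"
proof -
  let ?x = "poly h (int n)"
  have "[int (n + P) = int n] (mod int p ^ k)"
    by (simp add: P_def cong_iff_dvd_diff)
  then have "[poly h (int (n + P)) ^ (n + P) = ?x ^ (n + P)] (mod int p ^ k)"
    by (intro cong_pow poly_cong_int)
  also have "[?x ^ (n + P) = ?x ^ n] (mod int p ^ k)"
  proof (cases "int p dvd ?x")
    case True
    then have "int p ^ k dvd ?x ^ j" if "k \<le> j" for j
      by (meson dvd_power_le that)
    from this [of "n + P"] this [of n] show ?thesis
      using \<open>k \<le> n\<close> by (simp add: cong_iff_dvd_diff dvd_diff)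
  next
    case False
    from cong_scalar_left [OF euler_prime_power_int [OF \<open>prime p\<close> this, of k], of "?x ^ n"]
    show ?thesis
      by (simp add: P_def power_add)
  qed
  finally show ?thesis .
qed

section \<open>Shifted differences of linear recurrences and products over intervals\<close>

text \<open>Subtracting the recurrence at \<open>Suc (n + L)\<close> from its shift by
  \<open>P\<close> cancels the inhomogeneous terms modulo \<open>M\<close>, since that index exceeds
  \<open>N\<close>; each step thus multiplies the difference by one value of
  \<open>g\<close>.\<close>

lemma cong_diff_linear_recurrence:
  fixes a g c :: "nat \<Rightarrow> int"
  assumes rec: "\<And>n. a (Suc n) = g (Suc n) * a n + c (Suc n)"
    and g: "\<And>n. [g (n + P) = g n] (mod M)"
    and c: "\<And>n. n > N \<Longrightarrow> [c (n + P) = c n] (mod M)"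
    and "N \<le> n"
  shows "[a (n + L + P) - a (n + L) = (\<Prod>i\<in>{n<..n + L}. g i) * (a (n + P) - a n)] (mod M)"
proof (induction L)
  case (Suc L)
  let ?j = "n + L"
  have "[a (Suc (?j + P)) - a (Suc ?j) =
      (g (Suc ?j) * a (?j + P) + c (Suc ?j)) - a (Suc ?j)] (mod M)"
    unfolding rec [of "?j + P"]
    using g [of "Suc ?j"] c [of "Suc ?j"] \<open>N \<le> n\<close>
    by (intro cong_diff cong_add cong_mult) auto
  also have "(g (Suc ?j) * a (?j + P) + c (Suc ?j)) - a (Suc ?j) =
      g (Suc ?j) * (a (?j + P) - a ?j)"
    unfolding rec [of ?j] by (simp add: algebra_simps)
  also have "[\<dots> = g (Suc ?j) * ((\<Prod>i\<in>{n<..?j}. g i) * (a (n + P) - a n))] (mod M)"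
    by (rule cong_scalar_left) (rule Suc.IH)
  also have "g (Suc ?j) * ((\<Prod>i\<in>{n<..?j}. g i) * (a (n + P) - a n)) =
      (\<Prod>i\<in>{n<..n + Suc L}. g i) * (a (n + P) - a n)"
  proof -
    have "{n<..n + Suc L} = insert (Suc ?j) {n<..?j}"
      by auto
    then show ?thesis
      by (simp add: mult.assoc)
  qed
  finally show ?case
    by (simp add: add.commute add.left_commute)
qed simp

lemma prod_Ioc_add:
  fixes g :: "nat \<Rightarrow> 'a::comm_monoid_mult"
  shows "(\<Prod>i\<in>{n<..n + (L + K)}. g i) = (\<Prod>i\<in>{n<..n + L}. g i) * (\<Prod>i\<in>{n + L<..n + L + K}. g i)"
proof -
  have "{n<..n + (L + K)} = {n<..n + L} \<union> {n + L<..n + L + K}"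
    by auto
  then show ?thesis
    by (simp add: prod.union_disjoint ivl_disj_int)
qed

lemma prod_Ioc_shift:
  fixes g :: "nat \<Rightarrow> 'a::comm_monoid_mult"
  shows "(\<Prod>i\<in>{n + P<..n + P + L}. g i) = (\<Prod>i\<in>{n<..n + L}. g (i + P))"
  by (rule prod.reindex_bij_witness [of _ "\<lambda>i. i + P" "\<lambda>i. i - P"]) auto

lemma cong_prod_Ioc_shift:
  fixes g :: "nat \<Rightarrow> int"
  assumes "\<And>n. [g (n + P) = g n] (mod M)"
  shows "[(\<Prod>i\<in>{n + e * P<..n + e * P + L}. g i) = (\<Prod>i\<in>{n<..n + L}. g i)] (mod M)"
proof (induction e)
  case (Suc e)
  have "[(\<Prod>i\<in>{n + e * P + P<..n + e * P + P + L}. g i) =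
      (\<Prod>i\<in>{n + e * P<..n + e * P + L}. g i)] (mod M)"
    unfolding prod_Ioc_shift by (intro cong_prod assms)
  also note Suc.IH
  finally show ?case
    by (simp add: add.commute add.left_commute)
qed simp

text \<open>The interval splits into \<open>e\<close> blocks of length \<open>P\<close>, and by
  periodicity each block has the same product as the first.\<close>

lemma cong_prod_Ioc_power:
  fixes g :: "nat \<Rightarrow> int"
  assumes "\<And>n. [g (n + P) = g n] (mod M)"
  shows "[(\<Prod>i\<in>{n<..n + e * P}. g i) = (\<Prod>i\<in>{n<..n + P}. g i) ^ e] (mod M)"
proof (induction e)
  case (Suc e)
  have "[(\<Prod>i\<in>{n<..n + e * P}. g i) * (\<Prod>i\<in>{n + e * P<..n + e * P + P}. g i) =
      (\<Prod>i\<in>{n<..n + P}. g i) ^ e * (\<Prod>i\<in>{n<..n + P}. g i)] (mod M)"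
    by (intro cong_mult Suc.IH cong_prod_Ioc_shift assms)
  then show ?case
    unfolding prod_Ioc_add [symmetric] by (simp add: mult.commute add.commute)
qed simp

text \<open>Each of the \<open>m\<close> blocks of \<open>q\<close> consecutive integers meets the
  residue class of \<open>x\<close>, where \<open>f\<close> contributes a factor
  \<open>q\<close>.\<close>

lemma power_dvd_prod_poly_Ioc:
  fixes f :: "int poly"
  assumes "q > 0" and "int q dvd poly f x"
  shows "int q ^ m dvd (\<Prod>i\<in>{n<..n + m * q}. poly f (int i))"
proof (induction m)
  case (Suc m)
  let ?s = "n + m * q"
  \<comment> \<open>\<open>j\<close> is the member of the block congruent to \<open>x\<close>: its
    offset from the first element \<open>?s + 1\<close> is reduced modulo \<open>q\<close>.\<close>
  define j where "j = ?s + 1 + nat ((x - int ?s - 1) mod int q)"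
  have "nat ((x - int ?s - 1) mod int q) < q"
    using \<open>q > 0\<close> by (simp add: nat_less_iff)
  then have j: "j \<in> {?s<..?s + q}"
    by (simp add: j_def)
  have "int j = int ?s + 1 + (x - int ?s - 1) mod int q"
    using \<open>q > 0\<close> by (simp add: j_def)
  also have "[\<dots> = int ?s + 1 + (x - int ?s - 1)] (mod int q)"
    by (intro cong_add) simp_all
  finally have "[int j = x] (mod int q)"
    by simp
  with \<open>int q dvd poly f x\<close> have "int q dvd poly f (int j)"
    using cong_dvd_iff poly_cong_int by blast
  also have "poly f (int j) dvd (\<Prod>i\<in>{?s<..?s + q}. poly f (int i))"
    using j by (intro dvd_prodI) auto
  finally have "int q ^ m * int q dvd
      (\<Prod>i\<in>{n<..?s}. poly f (int i)) * (\<Prod>i\<in>{?s<..?s + q}. poly f (int i))"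
    by (intro mult_dvd_mono Suc.IH)
  then show ?case
    unfolding prod_Ioc_add [symmetric] by (simp add: mult.commute add.commute)
qed simp

section \<open>Periods of the sequence modulo a prime power\<close>

locale exp_poly_recurrence =
  fixes f h1 h2 :: "int poly" and a :: "nat \<Rightarrow> int"
  assumes rec: "a (Suc n) =
    poly f (int (Suc n)) * a n + poly h1 (int (Suc n)) * poly h2 (int (Suc n)) ^ Suc n"
begin

text \<open>The inhomogeneous terms involved have index greater than \<open>n\<close>, hence at
  least \<open>k\<close>, which is exactly the range where the self-powers of \<open>h2\<close> are
  periodic. This is the source of the bound \<open>k - 1\<close> on the starting index.\<close>

lemma cong_diff:
  assumes "prime p" and "k \<le> Suc n"
  defines "P \<equiv> p ^ k * (p - 1)"
  shows "[a (n + L + P) - a (n + L) =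
    (\<Prod>i\<in>{n<..n + L}. poly f (int i)) * (a (n + P) - a n)] (mod int p ^ k)"
proof (rule cong_diff_linear_recurrence [where N = n and
      c = "\<lambda>i. poly h1 (int i) * poly h2 (int i) ^ i"])
  show "[poly f (int (i + P)) = poly f (int i)] (mod int p ^ k)" for i
    by (rule poly_cong_int) (simp add: P_def cong_iff_dvd_diff)
  show "[poly h1 (int (i + P)) * poly h2 (int (i + P)) ^ (i + P) =
      poly h1 (int i) * poly h2 (int i) ^ i] (mod int p ^ k)" if "i > n" for i
  proof (rule cong_mult)
    show "[poly h1 (int (i + P)) = poly h1 (int i)] (mod int p ^ k)"
      by (rule poly_cong_int) (simp add: P_def cong_iff_dvd_diff)
    show "[poly h2 (int (i + P)) ^ (i + P) = poly h2 (int i) ^ i] (mod int p ^ k)"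
      unfolding P_def using assms(1,2) that by (intro cong_self_power_period) auto
  qed
qed (auto simp: rec)

text \<open>The bound on \<open>n\<close> leaves room for going back \<open>m * q\<close> steps,
  whose product of values of \<open>f\<close> vanishes modulo \<open>q ^ m\<close>, while the
  earlier index is still at least \<open>m - 1\<close>, as \<open>cong_diff\<close>
  requires.\<close>

lemma cong_period_root:
  assumes "prime q" and "int q dvd poly f x" and "(q + 1) * m \<le> Suc n"
  shows "[a (n + q ^ m * (q - 1)) = a n] (mod int q ^ m)"
proof (cases "m = 0")
  case False
  let ?P = "q ^ m * (q - 1)"
  define N where "N = n - m * q"
  \<comment> \<open>Since \<open>m\<close> is positive, the hypothesis gives
    \<open>m * q \<le> n\<close>, so the subtraction defining \<open>N\<close> is not
    truncated.\<close>
  have n: "n = N + m * q" "m \<le> Suc N"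
    using assms(3) False by (auto simp: N_def algebra_simps)
  have "[a (n + ?P) - a n =
      (\<Prod>i\<in>{N<..N + m * q}. poly f (int i)) * (a (N + ?P) - a N)] (mod int q ^ m)"
    unfolding n(1) by (rule cong_diff [OF \<open>prime q\<close> n(2)])
  moreover have "int q ^ m dvd (\<Prod>i\<in>{N<..N + m * q}. poly f (int i))"
    using assms(1,2) by (intro power_dvd_prod_poly_Ioc) (auto simp: prime_gt_0_nat)
  ultimately show ?thesis
    by (simp add: cong_iff_dvd_diff) (metis cong_dvd_iff cong_iff_dvd_diff dvd_mult2)
qed simp

text \<open>One factor \<open>p ^ k\<close> of the period makes the coefficients periodic; the other
  is the number of blocks of length \<open>P\<close> over which the differences are summed.\<close>

lemma cong_period_no_root:
  assumes "prime p" and no_root: "\<And>x. \<not> int p dvd poly f x"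
    and "k > 0" and "k \<le> Suc n"
  shows "[a (n + p ^ (2 * k) * (p - 1)) = a n] (mod int p ^ k)"
proof -
  define P where "P = p ^ k * (p - 1)"
  define u where "u = (\<Prod>i\<in>{n<..n + P}. poly f (int i))"
  have f_P: "[poly f (int (i + P)) = poly f (int i)] (mod int p ^ k)" for i
    by (rule poly_cong_int) (simp add: P_def cong_iff_dvd_diff)
  have f_p: "[poly f (int (i + p)) = poly f (int i)] (mod int p)" for i
    by (rule poly_cong_int) (simp add: cong_iff_dvd_diff)
  \<comment> \<open>Modulo \<open>p\<close> the values of \<open>f\<close> already have period
    \<open>p\<close>, and \<open>k > 0\<close> makes \<open>P\<close> a multiple of
    \<open>p\<close>. So \<open>u\<close> is a power of \<open>w ^ (p - 1)\<close>, where
    \<open>w\<close> is the product over one block of length \<open>p\<close>; no factor of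
    \<open>w\<close> is divisible by \<open>p\<close>, and Fermat applies.\<close>
  have u: "[u = 1] (mod int p)"
  proof -
    define w where "w = (\<Prod>i\<in>{n<..n + p}. poly f (int i))"
    have "\<not> int p dvd w"
      using \<open>prime p\<close> no_root by (auto simp: w_def prime_dvd_prod_iff)
    then have "[(w ^ (p - 1)) ^ (p ^ (k - 1)) = 1 ^ (p ^ (k - 1))] (mod int p)"
      by (intro cong_pow fermat_int \<open>prime p\<close>)
    moreover have "P = (p - 1) * p ^ (k - 1) * p"
      using \<open>k > 0\<close> by (cases k) (auto simp: P_def)
    then have "[u = w ^ ((p - 1) * p ^ (k - 1))] (mod int p)"
      unfolding u_def w_def by (simp only: cong_prod_Ioc_power [where g = "\<lambda>i. poly f (int i)", OF f_p])
    ultimately show ?thesis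
      by (simp add: power_mult cong_trans)
  qed
  have D: "[a (n + Suc i * P) - a (n + i * P) = u ^ i * (a (n + P) - a n)] (mod int p ^ k)" for i
  proof -
    have "[a (n + i * P + P) - a (n + i * P) =
        (\<Prod>j\<in>{n<..n + i * P}. poly f (int j)) * (a (n + P) - a n)] (mod int p ^ k)"
      unfolding P_def by (rule cong_diff) fact+
    also have "[(\<Prod>j\<in>{n<..n + i * P}. poly f (int j)) * (a (n + P) - a n) =
        u ^ i * (a (n + P) - a n)] (mod int p ^ k)"
      unfolding u_def
      by (rule cong_scalar_right)
        (rule cong_prod_Ioc_power [where g = "\<lambda>i. poly f (int i)", OF f_P])
    finally show ?thesis
      by (simp add: add.commute add.left_commute)
  qed
  \<comment> \<open>The differences telescope, and \<open>p ^ k * P\<close> is the claimed period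
    \<open>p ^ (2 * k) * (p - 1)\<close>.\<close>
  have "a (n + p ^ k * P) - a n = (\<Sum>i<p ^ k. a (n + Suc i * P) - a (n + i * P))"
    using sum_lessThan_telescope [of "\<lambda>i. a (n + i * P)" "p ^ k"] by simp
  also have "[\<dots> = (\<Sum>i<p ^ k. u ^ i * (a (n + P) - a n))] (mod int p ^ k)"
    by (intro cong_sum D)
  also have "(\<Sum>i<p ^ k. u ^ i * (a (n + P) - a n)) = (\<Sum>i<p ^ k. u ^ i) * (a (n + P) - a n)"
    by (simp add: sum_distrib_right)
  also have "[\<dots> = 0] (mod int p ^ k)"
    using dvd_geometric_sum [OF u, of k] by (simp add: cong_0_iff)
  finally show ?thesis
    by (simp add: cong_iff_dvd_diff P_def power_add mult_2 mult.assoc)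
qed

end

section \<open>From prime powers to the modulus \<open>d\<close>\<close>

lemma cong_period_multiple:
  fixes a :: "nat \<Rightarrow> int"
  assumes "\<And>n. n \<ge> n0 \<Longrightarrow> [a (n + T) = a n] (mod M)" and "T dvd S" and "n \<ge> n0"
  shows "[a (n + S) = a n] (mod M)"
proof -
  have "[a (n + e * T) = a n] (mod M)" for e
  proof (induction e)
    case (Suc e)
    have "[a (n + e * T + T) = a (n + e * T)] (mod M)"
      using \<open>n \<ge> n0\<close> by (intro assms(1)) simp
    from cong_trans [OF this Suc.IH] show ?case
      by (simp add: add.commute add.left_commute)
  qed simp
  with \<open>T dvd S\<close> show ?thesis
    by (metis dvdE mult.commute)
qed

lemma prod_coprime_dvd:
  fixes g :: "'b \<Rightarrow> 'a::semiring_gcd"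
  assumes "\<And>i j. i \<in> A \<Longrightarrow> j \<in> A \<Longrightarrow> i \<noteq> j \<Longrightarrow> coprime (g i) (g j)"
    and "\<And>i. i \<in> A \<Longrightarrow> g i dvd x"
  shows "(\<Prod>i\<in>A. g i) dvd x"
  using assms
proof (induction A rule: infinite_finite_induct)
  case (insert i A)
  have "coprime (g i) (\<Prod>j\<in>A. g j)"
    using insert.hyps insert.prems(1) by (intro prod_coprime_right) auto
  with insert show ?case
    by (simp add: divides_mult)
qed auto

theorem corollary2:
  fixes f h1 h2 :: "int poly"
    and a :: "nat \<Rightarrow> int"
    and d s t n0 :: nat
    and p k q m :: "nat \<Rightarrow> nat"
  assumes a_0: "a 0 = poly h1 0"
    and a_rec: "\<And>n. n > 0 \<Longrightarrow>
      a n = poly f (int n) * a (n - 1) + poly h1 (int n) * poly h2 (int n) ^ n"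
    and d_pos: "d > 0"
    and d_fact: "d = (\<Prod>i\<in>{1..s}. p i ^ k i) * (\<Prod>i\<in>{1..t}. q i ^ m i)"
    and p_prime: "\<And>i. i \<in> {1..s} \<Longrightarrow> prime (p i)"
    and q_prime: "\<And>i. i \<in> {1..t} \<Longrightarrow> prime (q i)"
    and p_distinct: "inj_on p {1..s}"
    and q_distinct: "inj_on q {1..t}"
    and pq_distinct: "p ` {1..s} \<inter> q ` {1..t} = {}"
    and k_pos: "\<And>i. i \<in> {1..s} \<Longrightarrow> k i > 0"
    and m_pos: "\<And>i. i \<in> {1..t} \<Longrightarrow> m i > 0"
    and p_not_dvd: "\<And>i. i \<in> {1..s} \<Longrightarrow> \<not> (\<exists>n::int. int (p i) dvd poly f n)"
    and q_dvd: "\<And>i. i \<in> {1..t} \<Longrightarrow> \<exists>n::int. int (q i) dvd poly f n"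
    and n0_p: "\<And>i. i \<in> {1..s} \<Longrightarrow> int n0 \<ge> int (k i) - 1"
    and n0_q: "\<And>i. i \<in> {1..t} \<Longrightarrow>
      int n0 \<ge> (int (q i) + 1) * int (multiplicity (q i) d) - 1"
  shows "is_period_from n0 (\<lambda>n. a n mod int d)
    (Lcm ({p i ^ (2 * k i) * (p i - 1) | i. i \<in> {1..s}} \<union>
          {q j ^ m j * (q j - 1) | j. j \<in> {1..t}}))"
proof -
  let ?A = "{p i ^ (2 * k i) * (p i - 1) | i. i \<in> {1..s}}"
  let ?B = "{q j ^ m j * (q j - 1) | j. j \<in> {1..t}}"
  let ?T = "Lcm (?A \<union> ?B)"
  interpret exp_poly_recurrence f h1 h2 a
    by unfold_locales (use a_rec in force)
  \<comment> \<open>\<open>Lcm\<close> on naturals is 0 for infinite sets and for sets containing 0;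
    excluding both makes the period positive.\<close>
  have "finite (?A \<union> ?B)"
    by auto
  moreover have pos: "r ^ e * (r - 1) > 0" if "prime r" for r e :: nat
    using prime_gt_1_nat [OF that] by simp
  have "x > 0" if "x \<in> ?A \<union> ?B" for x
    using that by (elim UnE CollectE exE conjE) (simp_all only: pos p_prime q_prime)
  then have "0 \<notin> ?A \<union> ?B"
    by (meson less_irrefl)
  ultimately have "?T \<noteq> 0"
    by (simp only: Lcm_0_iff not_False_eq_True)
  then have "?T > 0"
    by (simp only: neq0_conv)
  moreover have "a (n + ?T) mod int d = a n mod int d" if "n \<ge> n0" for n
  proof -
    let ?x = "a (n + ?T) - a n"
    have p_dvd: "int (p i ^ k i) dvd ?x" if i: "i \<in> {1..s}" for i
    proof -
      have "[a (n' + p i ^ (2 * k i) * (p i - 1)) = a n'] (mod int (p i) ^ k i)"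
        if "n' \<ge> n0" for n'
        using p_prime [OF i] p_not_dvd [OF i] k_pos [OF i] n0_p [OF i] that
        by (intro cong_period_no_root) auto
      moreover have "p i ^ (2 * k i) * (p i - 1) dvd ?T"
        using i by (intro dvd_Lcm) blast
      ultimately have "[a (n + ?T) = a n] (mod int (p i) ^ k i)"
        by (rule cong_period_multiple [where a = a, OF _ _ \<open>n \<ge> n0\<close>])
      then show ?thesis
        by (simp only: cong_iff_dvd_diff of_nat_power)
    qed
    have q_dvd': "int (q i ^ m i) dvd ?x" if i: "i \<in> {1..t}" for i
    proof -
      \<comment> \<open>The bound on \<open>n0\<close> is phrased by the valuation of
        \<open>d\<close>; \<open>m i\<close> is at most that valuation because
        \<open>q i ^ m i\<close> divides \<open>d\<close>.\<close>
      have "q i ^ m i dvd d"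
        unfolding d_fact using i by (intro dvd_mult dvd_prodI) auto
      then have "m i \<le> multiplicity (q i) d"
        using d_pos q_prime [OF i] by (intro multiplicity_geI) (auto simp: prime_gt_0_nat)
      then have "(q i + 1) * m i \<le> (q i + 1) * multiplicity (q i) d"
        by (rule mult_left_mono) simp
      also have "int ((q i + 1) * multiplicity (q i) d) \<le> int (Suc n0)"
        using n0_q [OF i] by (simp add: algebra_simps)
      then have "(q i + 1) * multiplicity (q i) d \<le> Suc n0"
        by (simp only: of_nat_le_iff)
      finally have n0: "(q i + 1) * m i \<le> Suc n0" .
      obtain x where "int (q i) dvd poly f x"
        using q_dvd [OF i] by blast
      then have "[a (n' + q i ^ m i * (q i - 1)) = a n'] (mod int (q i) ^ m i)"
        if "n' \<ge> n0" for n'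
        using q_prime [OF i] n0 that by (intro cong_period_root) auto
      moreover have "q i ^ m i * (q i - 1) dvd ?T"
        using i by (intro dvd_Lcm) blast
      ultimately have "[a (n + ?T) = a n] (mod int (q i) ^ m i)"
        by (rule cong_period_multiple [where a = a, OF _ _ \<open>n \<ge> n0\<close>])
      then show ?thesis
        by (simp only: cong_iff_dvd_diff of_nat_power)
    qed
    \<comment> \<open>Divisibility by each prime power is combined into divisibility by
      \<open>d\<close>: coprimality comes from injectivity within each family and from disjointness
      of the two families.\<close>
    have "(\<Prod>i\<in>{1..s}. int (p i ^ k i)) dvd ?x"
    proof (rule prod_coprime_dvd [OF _ p_dvd])
      fix i j
      assume "i \<in> {1..s}" "j \<in> {1..s}" "i \<noteq> j"
      then have "coprime (p i) (p j)"
        using p_distinct p_prime by (intro primes_coprime) (auto dest: inj_onD)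
      then show "coprime (int (p i ^ k i)) (int (p j ^ k j))"
        by simp
    qed
    moreover have "(\<Prod>i\<in>{1..t}. int (q i ^ m i)) dvd ?x"
    proof (rule prod_coprime_dvd [OF _ q_dvd'])
      fix i j
      assume "i \<in> {1..t}" "j \<in> {1..t}" "i \<noteq> j"
      then have "coprime (q i) (q j)"
        using q_distinct q_prime by (intro primes_coprime) (auto dest: inj_onD)
      then show "coprime (int (q i ^ m i)) (int (q j ^ m j))"
        by simp
    qed
    moreover have "coprime (\<Prod>i\<in>{1..s}. int (p i ^ k i)) (\<Prod>i\<in>{1..t}. int (q i ^ m i))"
    proof (intro prod_coprime_left prod_coprime_right)
      fix i j
      assume "i \<in> {1..s}" "j \<in> {1..t}"
      moreover from this have "p i \<noteq> q j"
        using pq_distinct by blast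
      ultimately have "coprime (p i) (q j)"
        using p_prime q_prime by (intro primes_coprime) auto
      then show "coprime (int (p i ^ k i)) (int (q j ^ m j))"
        by simp
    qed
    ultimately have "(\<Prod>i\<in>{1..s}. int (p i ^ k i)) * (\<Prod>i\<in>{1..t}. int (q i ^ m i)) dvd ?x"
      by (rule divides_mult)
    then have "int d dvd ?x"
      by (simp add: d_fact)
    then show ?thesis
      by (simp add: mod_eq_dvd_iff)
  qed
  ultimately show ?thesis
    by (simp add: is_period_from_def)
qed

end
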